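(* Let $h,g\in\ell^2(\mathbb{Z})$ with $h$ a low-pass filter and $g$ a high-pass filter. (a) If there is a constant $B$ such that, for every $j\in\mathbb{N}$, the finitely iterated dyadic filter bank of order $j$ generated by $h$ and $g$ is Bessel with bound $B$, then the infinitely iterated dyadic filter bank generated by $h$ and $g$ is also Bessel with bound $B$. (b) If there are constants $0<A\le B<\infty$ such that, for every $j\in\mathbb{N}$, the finitely iterated dyadic filter bank of order $j$ generated by $h$ and $g$ is stable with bounds $A,B$, and if for all $x\in\ell^2(\mathbb{Z})$ one has $\|(F_jx)_{j+1}\|\to0$ as $j\to\infty$, then the infinitely iterated dyadic filter bank generated by $h$ and $g$ is stable with bounds $A$ and $B$.
   Context: $\mathbb{N}=\{1,2,\dots\}$. For $x,y\in\ell^2(\mathbb{Z})$: $\hat x(\xi)=\sum_n x(n)e^{-2\pi i n\xi}$; $\langle x,y\rangle=\sum_m x(m)\overline{y(m)}$; convolution $(x*y)(k)=\sum_{n} y(n)x(k-n)$; involution $\overline{x}(k)=\overline{x(-k)}$; downsampling $Dx(n)=x(2n)$; upsampling $Ux(2m)=x(m)$, $Ux(n)=0$ for $n$ odd; translation $Tx(k)=x(k-1)$. A low-pass filter $h$ satisfies $\hat h(0)=\sqrt2$ and $\hat h(\frac12)=0$; a high-pass filter $g$ satisfies $\hat g(0)=0$. Given filters $h,g$, the iterated filters of order $j\in\mathbb{N}$ are $h_j=h*Uh*\cdots*U^{j-1}h$ and $g_j=h_{j-1}*U^{j-1}g$ (with $g_1=g$, i.e. $h_0=\delta_0$). Infinitely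 iterated dyadic filter bank: the analysis operator $F:\ell^2(\mathbb{Z})\to\bigoplus_{j=1}^\infty\ell^2(\mathbb{Z})$, $Fx=\{(Fx)_j\}_{j\ge1}$, has components $(Fx)_j=D^j(x*\overline{g_j})$, i.e. $(Fx)_j(k)=\langle x,T^{2^jk}g_j\rangle$. It is stable with bounds $0<A\le B<\infty$ if $A\|x\|^2\le\sum_{j=1}^\infty\|(Fx)_j\|^2\le B\|x\|^2$ for all $x\in\ell^2(\mathbb{Z})$; it is Bessel with bound $B$ if the right-hand inequality holds for all $x\in\ell^2(\mathbb{Z})$. Finitely iterated dyadic filter bank of order $j$: the analysis operator $F_j:\ell^2(\mathbb{Z})\to\bigoplus_{l=1}^{j+1}\ell^2(\mathbb{Z})$ has components $(F_jx)_l=D^l(x*\overline{g_l})$ for $1\le l\le j$ and $(F_jx)_{j+1}=D^j(x*\overline{h_j})$, i.e. $(F_jx)_{j+1}(k)=\langle x,T^{2^jk}h_j\rangle$. It is stable with bounds $0<A\le B<\infty$ if $A\|x\|^2\le\sum_{l=1}^{j+1}\|(F_jx)_l\|^2\le B\|x\|^2$ for all $x\in\ell^2(\mathbb{Z})$; it is Bessel with bound $B$ if the right-hand inequality holds for all $x\in\ell^2(\mathbb{Z})$. *)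

theory Defs
  imports "HOL-Analysis.Analysis"
begin

definition ell2 :: "(int \<Rightarrow> complex) set" where
  "ell2 = {x. (\<lambda>n. (cmod (x n))\<^sup>2) summable_on UNIV}"

definition ell2_norm :: "(int \<Rightarrow> complex) \<Rightarrow> real" where
  "ell2_norm x = sqrt (\<Sum>\<^sub>\<infinity>n. (cmod (x n))\<^sup>2)"

(* The Fourier series of x at xi converges to v. A square-summable x need not be summable, so
   the pointwise value is the limit of the symmetric partial sums; by Carleson's theorem this
   limit exists almost everywhere and represents the L2 Fourier transform of x. *)
definition has_fourier_value :: "(int \<Rightarrow> complex) \<Rightarrow> real \<Rightarrow> complex \<Rightarrow> bool" where
  "has_fourier_value x \<xi> v \<longleftrightarrow>
     (\<lambda>N. \<Sum>n = - int N..int N. x n * exp (- 2 * pi * \<i> * of_int n * of_real \<xi>))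
       \<longlonglongrightarrow> v"

definition low_pass :: "(int \<Rightarrow> complex) \<Rightarrow> bool" where
  "low_pass h \<longleftrightarrow> has_fourier_value h 0 (of_real (sqrt 2)) \<and> has_fourier_value h (1 / 2) 0"

definition high_pass :: "(int \<Rightarrow> complex) \<Rightarrow> bool" where
  "high_pass g \<longleftrightarrow> has_fourier_value g 0 0"

definition conv :: "(int \<Rightarrow> complex) \<Rightarrow> (int \<Rightarrow> complex) \<Rightarrow> (int \<Rightarrow> complex)" where
  "conv x y = (\<lambda>k. \<Sum>\<^sub>\<infinity>n. y n * x (k - n))"

definition involution :: "(int \<Rightarrow> complex) \<Rightarrow> (int \<Rightarrow> complex)" where
  "involution x = (\<lambda>k. cnj (x (- k)))"

definition downsample :: "(int \<Rightarrow> complex) \<Rightarrow> (int \<Rightarrow> complex)" where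
  "downsample x = (\<lambda>n. x (2 * n))"

definition upsample :: "(int \<Rightarrow> complex) \<Rightarrow> (int \<Rightarrow> complex)" where
  "upsample x = (\<lambda>n. if even n then x (n div 2) else 0)"

definition delta0 :: "int \<Rightarrow> complex" where
  "delta0 = (\<lambda>n. if n = 0 then 1 else 0)"

(* For h, g in ell2, the Bessel property of the bank of order 1 makes convolution with h and with
   g (hence with all their upsamplings) bounded on ell2. All iterated filters then lie in ell2, and
   every convolution below converges absolutely. *)
fun iter_low :: "(int \<Rightarrow> complex) \<Rightarrow> nat \<Rightarrow> (int \<Rightarrow> complex)" where
  "iter_low h 0 = delta0"
| "iter_low h (Suc j) = conv (iter_low h j) ((upsample ^^ j) h)"

(* Meaningful for j >= 1 only. *)
definition iter_high ::
    "(int \<Rightarrow> complex) \<Rightarrow> (int \<Rightarrow> complex) \<Rightarrow> nat \<Rightarrow> (int \<Rightarrow> complex)" where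
  "iter_high h g j = conv (iter_low h (j - 1)) ((upsample ^^ (j - 1)) g)"

definition inf_analysis ::
    "(int \<Rightarrow> complex) \<Rightarrow> (int \<Rightarrow> complex) \<Rightarrow> (int \<Rightarrow> complex) \<Rightarrow> nat \<Rightarrow> (int \<Rightarrow> complex)" where
  "inf_analysis h g x j = (downsample ^^ j) (conv x (involution (iter_high h g j)))"

definition fin_analysis ::
    "(int \<Rightarrow> complex) \<Rightarrow> (int \<Rightarrow> complex) \<Rightarrow> nat \<Rightarrow> (int \<Rightarrow> complex) \<Rightarrow> nat \<Rightarrow> (int \<Rightarrow> complex)" where
  "fin_analysis h g j x l =
     (if l \<le> j then (downsample ^^ l) (conv x (involution (iter_high h g l)))
      else (downsample ^^ j) (conv x (involution (iter_low h j))))"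

(* The Hilbert direct sum of copies of ell2 indexed by J; components outside J are ignored. *)
definition ell2_sum :: "nat set \<Rightarrow> (nat \<Rightarrow> int \<Rightarrow> complex) set" where
  "ell2_sum J = {y. (\<forall>j\<in>J. y j \<in> ell2) \<and> (\<lambda>j. (ell2_norm (y j))\<^sup>2) summable_on J}"

definition bessel_on ::
    "nat set \<Rightarrow> ((int \<Rightarrow> complex) \<Rightarrow> nat \<Rightarrow> (int \<Rightarrow> complex)) \<Rightarrow> real \<Rightarrow> bool" where
  "bessel_on J F B \<longleftrightarrow>
     (\<forall>x\<in>ell2. F x \<in> ell2_sum J \<and>
        (\<Sum>\<^sub>\<infinity>j\<in>J. (ell2_norm (F x j))\<^sup>2) \<le> B * (ell2_norm x)\<^sup>2)"

definition stable_on ::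
    "nat set \<Rightarrow> ((int \<Rightarrow> complex) \<Rightarrow> nat \<Rightarrow> (int \<Rightarrow> complex)) \<Rightarrow> real \<Rightarrow> real \<Rightarrow> bool" where
  "stable_on J F A B \<longleftrightarrow> 0 < A \<and> A \<le> B \<and>
     (\<forall>x\<in>ell2. F x \<in> ell2_sum J \<and>
        A * (ell2_norm x)\<^sup>2 \<le> (\<Sum>\<^sub>\<infinity>j\<in>J. (ell2_norm (F x j))\<^sup>2) \<and>
        (\<Sum>\<^sub>\<infinity>j\<in>J. (ell2_norm (F x j))\<^sup>2) \<le> B * (ell2_norm x)\<^sup>2)"

definition inf_bank_bessel :: "(int \<Rightarrow> complex) \<Rightarrow> (int \<Rightarrow> complex) \<Rightarrow> real \<Rightarrow> bool" where
  "inf_bank_bessel h g B \<longleftrightarrow> bessel_on {1..} (inf_analysis h g) B"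

definition inf_bank_stable :: "(int \<Rightarrow> complex) \<Rightarrow> (int \<Rightarrow> complex) \<Rightarrow> real \<Rightarrow> real \<Rightarrow> bool" where
  "inf_bank_stable h g A B \<longleftrightarrow> stable_on {1..} (inf_analysis h g) A B"

definition fin_bank_bessel :: "(int \<Rightarrow> complex) \<Rightarrow> (int \<Rightarrow> complex) \<Rightarrow> nat \<Rightarrow> real \<Rightarrow> bool" where
  "fin_bank_bessel h g j B \<longleftrightarrow> bessel_on {1..j + 1} (fin_analysis h g j) B"

definition fin_bank_stable ::
    "(int \<Rightarrow> complex) \<Rightarrow> (int \<Rightarrow> complex) \<Rightarrow> nat \<Rightarrow> real \<Rightarrow> real \<Rightarrow> bool" where
  "fin_bank_stable h g j A B \<longleftrightarrow> stable_on {1..j + 1} (fin_analysis h g j) A B"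

end

theory Submission
  imports Defs
begin

text \<open>
  For \<open>l \<le> j\<close> the component \<open>l\<close> of the bank of order \<open>j\<close> does not depend on \<open>j\<close>: it is the
  component \<open>l\<close> of the infinitely iterated bank. Writing \<open>E l\<close> for the energy of that component
  and \<open>R j\<close> for the energy of the remaining low-pass component, the energy captured at order \<open>j\<close>
  is \<open>E 1 + \<dots> + E j + R j\<close> (\<open>fin_energy_split\<close>).

  Since \<open>R j \<ge> 0\<close>, a Bessel bound that is uniform in \<open>j\<close> bounds all initial sums of the
  nonnegative series of the \<open>E l\<close>; hence the series converges and inherits the bound
  (\<open>summable_of_bounded_initial_sums\<close>). For the lower bound, the initial sums are at most the full
  sum \<open>S\<close>, so \<open>A \<parallel>x\<parallel>\<^sup>2 \<le> S + R j\<close> for every \<open>j\<close>, and \<open>R j \<rightarrow> 0\<close>.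
\<close>

lemma summable_of_bounded_initial_sums:
  fixes a :: "nat \<Rightarrow> real"
  assumes nonneg: "\<And>l. 0 \<le> a l" and bound: "\<And>j. j \<ge> 1 \<Longrightarrow> sum a {1..j} \<le> C"
  shows "a summable_on {1..}" and "infsum a {1..} \<le> C"
proof -
  have fin_bound: "sum a K \<le> C" if K: "finite K" "K \<subseteq> {1..}" for K
  proof -
    \<comment> \<open>Inserting 1 makes the enclosing initial segment nonempty also when \<open>K\<close> is empty.\<close>
    define m where "m = Max (insert 1 K)"
    have "m \<ge> 1" and "K \<subseteq> {1..m}"
      using K by (auto simp: m_def)
    then have "sum a K \<le> sum a {1..m}"
      by (intro sum_mono2) (auto simp: nonneg)
    also have "\<dots> \<le> C"
      by (rule bound) fact
    finally show ?thesis .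
  qed
  show summable: "a summable_on {1..}"
  proof (rule nonneg_bdd_above_summable_on)
    show "bdd_above (sum a ` {K. K \<subseteq> {1..} \<and> finite K})"
      using fin_bound by (intro bdd_aboveI[of _ C]) auto
  qed (rule nonneg)
  show "infsum a {1..} \<le> C"
    by (rule infsum_le_finite_sums[OF summable fin_bound])
qed

lemma fin_analysis_eq_inf_analysis:
  "l \<le> j \<Longrightarrow> fin_analysis h g j x l = inf_analysis h g x l"
  by (simp add: fin_analysis_def inf_analysis_def)

lemma fin_energy_split:
  "(\<Sum>\<^sub>\<infinity>l\<in>{1..j + 1}. (ell2_norm (fin_analysis h g j x l))\<^sup>2) =
     (\<Sum>l = 1..j. (ell2_norm (inf_analysis h g x l))\<^sup>2)
       + (ell2_norm (fin_analysis h g j x (j + 1)))\<^sup>2"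
  by (simp add: fin_analysis_eq_inf_analysis)

lemma inf_bank_energy_bound:
  assumes bessel: "\<And>j. j \<ge> 1 \<Longrightarrow> fin_bank_bessel h g j B" and x: "x \<in> ell2"
  shows "inf_analysis h g x \<in> ell2_sum {1..}"
    and "(\<Sum>\<^sub>\<infinity>l\<in>{1..}. (ell2_norm (inf_analysis h g x l))\<^sup>2) \<le> B * (ell2_norm x)\<^sup>2"
proof -
  let ?E = "\<lambda>l. (ell2_norm (inf_analysis h g x l))\<^sup>2"
  have "sum ?E {1..j} \<le> B * (ell2_norm x)\<^sup>2" if "j \<ge> 1" for j
  proof -
    have "sum ?E {1..j} + (ell2_norm (fin_analysis h g j x (j + 1)))\<^sup>2 \<le> B * (ell2_norm x)\<^sup>2"
      using bessel[OF that] x unfolding fin_bank_bessel_def bessel_on_def fin_energy_split by blast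
    then show ?thesis
      using zero_le_power2[of "ell2_norm (fin_analysis h g j x (j + 1))"] by linarith
  qed
  note series = summable_of_bounded_initial_sums[of ?E, OF zero_le_power2 this]
  \<comment> \<open>Square-summability of component \<open>l\<close> is read off from the bank of order \<open>l\<close> itself.\<close>
  have "inf_analysis h g x l \<in> ell2" if "l \<ge> 1" for l
  proof -
    have "fin_analysis h g l x l \<in> ell2"
      using bessel[OF that] x that
      by (auto simp: fin_bank_bessel_def bessel_on_def ell2_sum_def)
    then show ?thesis
      by (simp add: fin_analysis_eq_inf_analysis)
  qed
  then show "inf_analysis h g x \<in> ell2_sum {1..}"
    using series(1) by (simp add: ell2_sum_def)
  show "infsum ?E {1..} \<le> B * (ell2_norm x)\<^sup>2"
    by (rule series(2))
qed

lemma inf_bank_besselI: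
  assumes "\<And>j. j \<ge> 1 \<Longrightarrow> fin_bank_bessel h g j B"
  shows "inf_bank_bessel h g B"
  unfolding inf_bank_bessel_def bessel_on_def
  using inf_bank_energy_bound[OF assms] by blast

lemma fin_bank_stable_imp_bessel: "fin_bank_stable h g j A B \<Longrightarrow> fin_bank_bessel h g j B"
  by (simp add: fin_bank_stable_def fin_bank_bessel_def stable_on_def bessel_on_def)

text \<open>
  The energy of the low-pass component is the only part of the order \<open>j\<close> energy that the infinite
  bank does not see, so its decay is exactly what lets the lower bound survive the limit.
\<close>

lemma inf_bank_energy_lower_bound:
  assumes stable: "\<And>j. j \<ge> 1 \<Longrightarrow> fin_bank_stable h g j A B" and x: "x \<in> ell2"
    and decay: "(\<lambda>j. ell2_norm (fin_analysis h g j x (j + 1))) \<longlonglongrightarrow> 0"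
  shows "A * (ell2_norm x)\<^sup>2 \<le> (\<Sum>\<^sub>\<infinity>l\<in>{1..}. (ell2_norm (inf_analysis h g x l))\<^sup>2)"
proof -
  let ?E = "\<lambda>l. (ell2_norm (inf_analysis h g x l))\<^sup>2"
  let ?R = "\<lambda>j. (ell2_norm (fin_analysis h g j x (j + 1)))\<^sup>2"
  have summable: "?E summable_on {1..}"
    using inf_bank_energy_bound(1)[OF fin_bank_stable_imp_bessel[OF stable] x]
    by (simp add: ell2_sum_def)
  have "A * (ell2_norm x)\<^sup>2 \<le> infsum ?E {1..} + ?R j" if "j \<ge> 1" for j
  proof -
    have "A * (ell2_norm x)\<^sup>2 \<le> sum ?E {1..j} + ?R j"
      using stable[OF that] x unfolding fin_bank_stable_def stable_on_def fin_energy_split by blast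
    moreover have "sum ?E {1..j} \<le> infsum ?E {1..}"
      by (rule finite_sum_le_infsum[OF summable]) auto
    ultimately show ?thesis
      by linarith
  qed
  moreover have "(\<lambda>j. infsum ?E {1..} + ?R j) \<longlonglongrightarrow> infsum ?E {1..} + 0\<^sup>2"
    by (intro tendsto_intros decay)
  ultimately show ?thesis
    by (intro LIMSEQ_le_const[of _ "infsum ?E {1..}"]) auto
qed

theorem theorem3p4:
  fixes h g :: "int \<Rightarrow> complex"
  assumes "h \<in> ell2" and "g \<in> ell2"
    and "low_pass h" and "high_pass g"
  shows "(\<forall>B. (\<forall>j\<ge>1. fin_bank_bessel h g j B) \<longrightarrow> inf_bank_bessel h g B) \<and>
    (\<forall>A B. 0 < A \<and> A \<le> B \<and> (\<forall>j\<ge>1. fin_bank_stable h g j A B) \<and>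
        (\<forall>x\<in>ell2. (\<lambda>j. ell2_norm (fin_analysis h g j x (j + 1))) \<longlonglongrightarrow> 0)
      \<longrightarrow> inf_bank_stable h g A B)"
proof (intro conjI allI impI)
  fix B
  assume "\<forall>j\<ge>1. fin_bank_bessel h g j B"
  then show "inf_bank_bessel h g B"
    by (intro inf_bank_besselI) blast
next
  fix A B
  assume *: "0 < A \<and> A \<le> B \<and> (\<forall>j\<ge>1. fin_bank_stable h g j A B) \<and>
    (\<forall>x\<in>ell2. (\<lambda>j. ell2_norm (fin_analysis h g j x (j + 1))) \<longlonglongrightarrow> 0)"
  then have stable: "\<And>j. j \<ge> 1 \<Longrightarrow> fin_bank_stable h g j A B"
    by blast
  have "A * (ell2_norm x)\<^sup>2 \<le> (\<Sum>\<^sub>\<infinity>l\<in>{1..}. (ell2_norm (inf_analysis h g x l))\<^sup>2)"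
    if "x \<in> ell2" for x
    using * that by (intro inf_bank_energy_lower_bound[OF stable]) auto
  moreover have "inf_bank_bessel h g B"
    by (intro inf_bank_besselI fin_bank_stable_imp_bessel[OF stable])
  ultimately show "inf_bank_stable h g A B"
    using * unfolding inf_bank_stable_def inf_bank_bessel_def stable_on_def bessel_on_def by blast
qed

end
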